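(* Let $\mathrm{R}_B>0$, let $B$ be a circle in the Euclidean plane $\mathbb{R}^2$ with center $\mathbf{c}_B$ and radius $\mathrm{R}_B$, and let $L$ be a real number with $L\le 2\mathrm{R}_B$. Let $\mathbf{z}_1,\mathbf{z}_2\in\mathbb{R}^2$ be any two points that are not interior points of $B$ (that is, $\|\mathbf{z}_1-\mathbf{c}_B\|\ge \mathrm{R}_B$ and $\|\mathbf{z}_2-\mathbf{c}_B\|\ge \mathrm{R}_B$), such that the length $\|\mathbf{z}_1-\mathbf{z}_2\|$ of the line segment $\overline{\mathbf{z}_1\mathbf{z}_2}$ is less than $L$. Then the distance between the line segment and the center of the circle satisfies $$d(\overline{\mathbf{z}_1\mathbf{z}_2},\mathbf{c}_B)\ \ge\ \sqrt{\mathrm{R}_B^2-\left(\frac{L}{2}\right)^2}.$$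
   Context: $\|\cdot\|$ is the Euclidean norm on $\mathbb{R}^2$. $\overline{\mathbf{z}_1\mathbf{z}_2}$ denotes the closed line segment with endpoints $\mathbf{z}_1,\mathbf{z}_2$. The interior points of a circle with center $\mathbf{c}_B$ and radius $\mathrm{R}_B$ are the points $\mathbf{z}$ with $\|\mathbf{z}-\mathbf{c}_B\|<\mathrm{R}_B$. The distance between a segment and a point is $d(\overline{\mathbf{z}_1\mathbf{z}_2},\mathbf{c}_B)=\min_{\mathbf{z}\in\overline{\mathbf{z}_1\mathbf{z}_2}}\|\mathbf{z}-\mathbf{c}_B\|$. *)

theory Defs
  imports "HOL-Analysis.Analysis"
begin

text \<open>The distance from a point to a segment is rendered by \<^const>\<open>infdist\<close>, which is
  an infimum; the following fact shows that on a closed segment it is the minimum of the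
  norms \<open>norm (z - c)\<close>.\<close>

lemma infdist_closed_segment_is_min:
  fixes z1 z2 c :: "real ^ 2"
  shows "is_arg_min (\<lambda>z. norm (z - c)) (\<lambda>z. z \<in> closed_segment z1 z2) z
    \<Longrightarrow> infdist c (closed_segment z1 z2) = norm (z - c)"
    and "\<exists>z. is_arg_min (\<lambda>z. norm (z - c)) (\<lambda>z. z \<in> closed_segment z1 z2) z"
proof -
  have ne: "closed_segment z1 z2 \<noteq> {}" by auto
  obtain w where w: "w \<in> closed_segment z1 z2" "infdist c (closed_segment z1 z2) = dist c w"
    using infdist_attains_inf[OF closed_segment[of z1 z2] ne] by metis
  have le: "infdist c (closed_segment z1 z2) \<le> norm (v - c)" if "v \<in> closed_segment z1 z2" for v
    using infdist_le[OF that, of c] by (simp add: dist_norm norm_minus_commute)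
  have eq: "infdist c (closed_segment z1 z2) = norm (w - c)"
    using w(2) by (simp add: dist_norm norm_minus_commute)
  show "\<exists>z. is_arg_min (\<lambda>z. norm (z - c)) (\<lambda>z. z \<in> closed_segment z1 z2) z"
    using w(1) le eq by (auto simp: is_arg_min_linorder)
  show "infdist c (closed_segment z1 z2) = norm (z - c)"
    if "is_arg_min (\<lambda>z. norm (z - c)) (\<lambda>z. z \<in> closed_segment z1 z2) z"
    using that w(1) eq le[of z] by (auto simp: is_arg_min_linorder intro: antisym)
qed

end

theory Submission
  imports Defs
begin

text \<open>A point \<open>z\<close> that divides the segment in the ratio \<open>t : 1 - t\<close> has, by Stewart's theorem,
  squared distance from the centre equal to the corresponding weighted mean of the squared
  distances of the endpoints, minus \<open>t (1 - t)\<close> times the squared length of the segment. The mean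
  is at least \<open>R\<^sup>2\<close> because neither endpoint is inside the circle, and \<open>t (1 - t) \<le> 1/4\<close>, so the
  squared distance is at least \<open>R\<^sup>2 - (L / 2)\<^sup>2\<close>. The limiting case is the midpoint of a chord of
  length \<open>L\<close>.\<close>

text \<open>Stewart's theorem with the apex at the origin; expanding both sides in inner products
  proves it in any inner product space.\<close>

lemma stewart_norm:
  fixes a b :: "'a::real_inner"
  shows "(norm ((1 - t) *\<^sub>R a + t *\<^sub>R b))\<^sup>2
    = (1 - t) * (norm a)\<^sup>2 + t * (norm b)\<^sup>2 - t * (1 - t) * (norm (a - b))\<^sup>2"
  unfolding power2_norm_eq_inner
  by (simp add: inner_simps inner_commute[of b a] algebra_simps)

lemma norm_closed_segment_lower_bound:
  fixes z1 z2 c :: "'a::real_inner"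
  assumes "0 \<le> R" "R \<le> norm (z1 - c)" "R \<le> norm (z2 - c)" and z: "z \<in> closed_segment z1 z2"
  shows "R\<^sup>2 - (norm (z1 - z2) / 2)\<^sup>2 \<le> (norm (z - c))\<^sup>2"
proof -
  obtain t where t: "0 \<le> t" "t \<le> 1" and zt: "z = (1 - t) *\<^sub>R z1 + t *\<^sub>R z2"
    using z by (auto simp: in_segment)
  have "z - c = (1 - t) *\<^sub>R (z1 - c) + t *\<^sub>R (z2 - c)"
    by (simp add: zt algebra_simps)
  then have eq: "(norm (z - c))\<^sup>2 = (1 - t) * (norm (z1 - c))\<^sup>2 + t * (norm (z2 - c))\<^sup>2
      - t * (1 - t) * (norm (z1 - z2))\<^sup>2"
    using stewart_norm[of t "z1 - c" "z2 - c"] by simp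
  have "R\<^sup>2 \<le> (norm (z1 - c))\<^sup>2" "R\<^sup>2 \<le> (norm (z2 - c))\<^sup>2"
    using assms by (auto intro: power_mono)
  then have "(1 - t) * R\<^sup>2 + t * R\<^sup>2 \<le> (1 - t) * (norm (z1 - c))\<^sup>2 + t * (norm (z2 - c))\<^sup>2"
    using t by (intro add_mono mult_left_mono) auto
  then have mean: "R\<^sup>2 \<le> (1 - t) * (norm (z1 - c))\<^sup>2 + t * (norm (z2 - c))\<^sup>2"
    by (simp add: algebra_simps)
  have "t * (1 - t) \<le> 1 / 4"
    using zero_le_power2[of "t - 1 / 2"] by (simp add: power2_eq_square algebra_simps)
  then have "t * (1 - t) * (norm (z1 - z2))\<^sup>2 \<le> 1 / 4 * (norm (z1 - z2))\<^sup>2"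
    by (intro mult_right_mono) auto
  with eq mean show ?thesis
    by (simp add: power_divide)
qed

theorem theorem1:
  fixes R_B L :: real and c_B z1 z2 :: "real ^ 2"
  assumes "R_B > 0"
    and "L \<le> 2 * R_B"
    and "norm (z1 - c_B) \<ge> R_B"
    and "norm (z2 - c_B) \<ge> R_B"
    and "norm (z1 - z2) < L"
  shows "infdist c_B (closed_segment z1 z2) \<ge> sqrt (R_B\<^sup>2 - (L / 2)\<^sup>2)"
proof -
  obtain z where z: "z \<in> closed_segment z1 z2"
    and dist: "infdist c_B (closed_segment z1 z2) = norm (z - c_B)"
    using infdist_closed_segment_is_min[of c_B z1 z2] by (auto simp: is_arg_min_def)
  have "(norm (z1 - z2) / 2)\<^sup>2 \<le> (L / 2)\<^sup>2"
    using assms(5) by (intro power_mono) auto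
  moreover have "R_B\<^sup>2 - (norm (z1 - z2) / 2)\<^sup>2 \<le> (norm (z - c_B))\<^sup>2"
    using norm_closed_segment_lower_bound[OF _ assms(3,4) z] assms(1) by simp
  ultimately have "R_B\<^sup>2 - (L / 2)\<^sup>2 \<le> (norm (z - c_B))\<^sup>2"
    by linarith
  then show ?thesis
    unfolding dist by (intro real_le_lsqrt) auto
qed

end
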